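(* Let $\mathbb{F}_q$ be a finite field, let $\mathbb{F}_Q$ ($Q=q^m$) be a finite extension of it, and let $\alpha_1,\alpha_2\in\mathbb{F}_Q^*$ be two elements which are not conjugate to each other over $\mathbb{F}_q$. Let $n_i$ be the multiplicative order of $\alpha_i$, let $\mathbb{F}_{Q_i}=\mathbb{F}_q(\alpha_i)$ with $Q_i=q^{k_i}$ ($i=1,2$), and let $n=n_1n_2/\gcd(n_1,n_2)$. Let $C=\{c(\beta_1,\beta_2):\beta_1\in\mathbb{F}_{Q_1},\beta_2\in\mathbb{F}_{Q_2}\}\subset\mathbb{F}_q^n$ and $C'=\{c(0,\beta_2):\beta_2\in\mathbb{F}_{Q_2}\}\subset C$, where $c(\beta_1,\beta_2)=\big(T_q^{Q_1}(\beta_1\alpha_1^i)+T_q^{Q_2}(\beta_2\alpha_2^i)\big)_{0\le i\le n-1}$. Then for every $1\leq j\leq k_1$, $$M_j(C,C')=n-N_j,$$ where $$N_j=\max\left\{|H\cap \langle(\alpha_1,\alpha_2)\rangle| \,:\, H \text{ an } \mathbb{F}_q\text{-linear subspace of } \mathbb{F}_{Q_1}\times\mathbb{F}_{Q_2},\ \dim_{\mathbb{F}_q}H=k_1+k_2-j,\ \pi_2(H)=\mathbb{F}_{Q_2}\right\},$$ and $\langle(\alpha_1,\alpha_2)\rangle=\{(\alpha_1^i,\alpha_2^i): 1\leq i\leq n\}$ is the subgroup of $\mathbb{F}_{Q_1}^*\times\mathbb{F}_{Q_2}^*$ generated by $(\alpha_1,\alpha_2)$.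
   Context: $T_q^{Q_i}$ denotes the trace map from $\mathbb{F}_{Q_i}$ to $\mathbb{F}_q$. $\pi_2$ denotes the projection $(\beta_1,\beta_2)\mapsto\beta_2$ from $\mathbb{F}_{Q_1}\times\mathbb{F}_{Q_2}$ to $\mathbb{F}_{Q_2}$. The code $C$ has dimension $k_1+k_2$ over $\mathbb{F}_q$ and $C'$ has dimension $k_2$. For an $\mathbb{F}_q$-linear subspace $D\subset\mathbb{F}_q^n$, $\mathrm{Supp}(D)$ is the set of coordinate positions $i$ such that $v_i\neq 0$ for some $v\in D$. For linear codes $C'\subset C\subset \mathbb{F}_q^n$ and $1\le j\le \dim C-\dim C'$, the $j$th relative generalized Hamming weight of $C$ with respect to $C'$ is $$M_j(C,C')=\min\{|\mathrm{Supp}(D)| : D\subset C \text{ an } \mathbb{F}_q\text{-linear subspace},\ \dim D=j,\ D\cap C'=\{0\}\}.$$ *)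

theory Defs
  imports "HOL-Library.Function_Algebras" "HOL-Library.Product_Plus"
    "HOL-Library.Cardinality" "HOL-Computational_Algebra.Polynomial"
begin

text \<open>A field extension is given by a field homomorphism from the small field (a type) into the
  large field (a type); the small field is identified with \<open>range h\<close>.\<close>

locale field_embedding =
  fixes h :: "'k::field \<Rightarrow> 'l::field"
  assumes hom_add: "h (a + b) = h a + h b"
    and hom_mult: "h (a * b) = h a * h b"
    and hom_one: "h 1 = 1"

definition is_subfield :: "'l::field set \<Rightarrow> bool" where
  "is_subfield S \<longleftrightarrow> 0 \<in> S \<and> 1 \<in> S \<and>
     (\<forall>x\<in>S. \<forall>y\<in>S. x - y \<in> S \<and> x * y \<in> S) \<and> (\<forall>x\<in>S. inverse x \<in> S)"

definition adjoin :: "('k::field \<Rightarrow> 'l::field) \<Rightarrow> 'l \<Rightarrow> 'l set" where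
  "adjoin h \<alpha> = is_subfield hull (insert \<alpha> (range h))"

text \<open>Conjugacy over the small field: having the same minimal polynomial, i.e. being roots of a
  common irreducible polynomial.\<close>

definition conjugate_over :: "('k::field \<Rightarrow> 'l::field) \<Rightarrow> 'l \<Rightarrow> 'l \<Rightarrow> bool" where
  "conjugate_over h \<alpha> \<beta> \<longleftrightarrow>
     (\<exists>p. irreducible p \<and> poly (map_poly h p) \<alpha> = 0 \<and> poly (map_poly h p) \<beta> = 0)"

definition mult_order :: "'l::field \<Rightarrow> nat" where
  "mult_order \<alpha> = (LEAST k. 0 < k \<and> \<alpha> ^ k = 1)"

text \<open>Scalar multiplications by the small field on the large field, on pairs of elements of the
  large field, and on words.  The notions of subspace and dimension are those of the locales
  \<open>module\<close> and \<open>vector_space\<close>.\<close>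

definition ext_scale :: "('k::field \<Rightarrow> 'l::field) \<Rightarrow> 'k \<Rightarrow> 'l \<Rightarrow> 'l" where
  "ext_scale h c x = h c * x"

definition pair_scale :: "('k::field \<Rightarrow> 'l::field) \<Rightarrow> 'k \<Rightarrow> 'l \<times> 'l \<Rightarrow> 'l \<times> 'l" where
  "pair_scale h c p = (h c * fst p, h c * snd p)"

definition word_scale :: "'k::field \<Rightarrow> (nat \<Rightarrow> 'k) \<Rightarrow> nat \<Rightarrow> 'k" where
  "word_scale c v = (\<lambda>i. c * v i)"

lemma (in field_embedding) vector_space_ext_scale: "vector_space (ext_scale h)"
  by unfold_locales (simp_all add: ext_scale_def hom_add hom_mult hom_one algebra_simps)

lemma (in field_embedding) vector_space_pair_scale: "vector_space (pair_scale h)"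
  by unfold_locales
    (simp_all add: pair_scale_def hom_add hom_mult hom_one algebra_simps prod_eq_iff)

lemma vector_space_word_scale: "vector_space word_scale"
  by unfold_locales (simp_all add: word_scale_def fun_eq_iff algebra_simps)

text \<open>The trace from a finite intermediate field \<open>F\<close> of degree \<open>d\<close> to the small field with \<open>q\<close>
  elements is \<open>x + x^q + \<dots> + x^(q^(d-1))\<close>.  For \<open>x\<close> in \<open>F\<close> this sum lies in \<open>range h\<close>, and \<open>inv h\<close>
  reads it as an element of the small field.\<close>

definition rel_trace :: "('k::{field,finite} \<Rightarrow> 'l::field) \<Rightarrow> 'l set \<Rightarrow> 'l \<Rightarrow> 'k" where
  "rel_trace h F x = inv h (\<Sum>s<vector_space.dim (ext_scale h) F. x ^ (CARD('k) ^ s))"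

text \<open>Words of length \<open>n\<close> are functions on \<open>nat\<close> vanishing outside \<open>{..<n}\<close>.\<close>

definition codeword ::
    "('k::{field,finite} \<Rightarrow> 'l::field) \<Rightarrow> 'l \<Rightarrow> 'l \<Rightarrow> nat \<Rightarrow> 'l \<Rightarrow> 'l \<Rightarrow> nat \<Rightarrow> 'k" where
  "codeword h \<alpha>1 \<alpha>2 n \<beta>1 \<beta>2 = (\<lambda>i. if i < n
     then rel_trace h (adjoin h \<alpha>1) (\<beta>1 * \<alpha>1 ^ i) + rel_trace h (adjoin h \<alpha>2) (\<beta>2 * \<alpha>2 ^ i)
     else 0)"

definition Supp :: "(nat \<Rightarrow> 'k::zero) set \<Rightarrow> nat set" where
  "Supp D = {i. \<exists>v\<in>D. v i \<noteq> 0}"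

definition rel_gen_hamming_weight ::
    "nat \<Rightarrow> (nat \<Rightarrow> 'k::field) set \<Rightarrow> (nat \<Rightarrow> 'k) set \<Rightarrow> nat" where
  "rel_gen_hamming_weight j C C' =
     Min {card (Supp D) | D. D \<subseteq> C \<and> module.subspace word_scale D \<and>
       vector_space.dim word_scale D = j \<and> D \<inter> C' = {0}}"

end

theory Submission imports Defs begin

text \<open>The trace form \<open>((\<beta>1, \<beta>2), (x1, x2)) \<mapsto> T(\<beta>1 x1) + T(\<beta>2 x2)\<close> on \<open>V = F1 \<times> F2\<close> is nondegenerate,
  and a codeword lists the values of the form at the points of the cyclic group generated by
  \<open>(\<alpha>1, \<alpha>2)\<close>. Since \<open>\<alpha>1\<close> and \<open>\<alpha>2\<close> are not conjugate, \<open>V\<close> embeds into the space of words, so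
  the subcodes \<open>D\<close> correspond to subspaces \<open>U\<close> of \<open>V\<close>, and the positions outside the support of \<open>D\<close>
  are the points lying in \<open>H = U\<^sup>\<bottom>\<close>. Duality turns \<open>D \<inter> C' = 0\<close>, that is \<open>U \<inter> (0 \<times> F2) = 0\<close>, into
  \<open>H + (F1 \<times> 0) = V\<close>, that is \<open>\<pi>2(H) = F2\<close>.\<close>

section \<open>Counting and orthogonality over a finite field\<close>

lemma one_less_card_field: "1 < CARD('a::{zero_neq_one,finite})"
proof -
  have "card {0, 1 :: 'a} \<le> CARD('a)" by (rule card_mono) auto
  then show ?thesis by simp
qed

text \<open>Subtracting a fixed point of a nonempty fibre of \<open>g\<close> maps that fibre
  injectively into the kernel, and the fibres are indexed by the \<open>CARD('k)\<close> possible
  values.\<close>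

lemma card_le_card_kernel:
  fixes g :: "'b::ab_group_add \<Rightarrow> 'k::{ab_group_add,finite}"
  assumes fin: "finite S"
    and diff: "\<And>x y. x \<in> S \<Longrightarrow> y \<in> S \<Longrightarrow> x - y \<in> S"
    and hom: "\<And>x y. x \<in> S \<Longrightarrow> y \<in> S \<Longrightarrow> g (x - y) = g x - g y"
  shows "card S \<le> card {x \<in> S. g x = 0} * CARD('k)"
proof -
  have fibre: "card {x \<in> S. g x = a} \<le> card {x \<in> S. g x = 0}" for a
  proof (cases "\<exists>z\<in>S. g z = a")
    case True
    then obtain z where z: "z \<in> S" "g z = a" by blast
    have "inj_on (\<lambda>x. x - z) {x \<in> S. g x = a}"
      by (auto simp: inj_on_def)
    moreover have "(\<lambda>x. x - z) ` {x \<in> S. g x = a} \<subseteq> {x \<in> S. g x = 0}"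
      using z by (auto simp: diff hom)
    ultimately show ?thesis
      using fin by (intro card_inj_on_le[of "\<lambda>x. x - z"]) auto
  next
    case False
    then have "{x \<in> S. g x = a} = {}" by auto
    then show ?thesis by (metis card.empty zero_le)
  qed
  have "S = (\<Union>a\<in>UNIV. {x \<in> S. g x = a})" by auto
  then have "card S \<le> (\<Sum>a\<in>UNIV. card {x \<in> S. g x = a})"
    by (metis card_UN_le finite)
  also have "\<dots> \<le> (\<Sum>a\<in>(UNIV::'k set). card {x \<in> S. g x = 0})"
    by (intro sum_mono fibre)
  finally show ?thesis by (simp add: mult.commute)
qed

text \<open>A counting form of the fact that each linear condition lowers the dimension by at most
  one. Closure of \<open>S\<close> under differences is enough for the induction, since the common
  kernels inherit it.\<close>

lemma card_le_card_common_kernel: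
  fixes g :: "'c \<Rightarrow> 'b::ab_group_add \<Rightarrow> 'k::{ab_group_add,finite}"
  assumes "finite W" and fin: "finite S"
    and diff: "\<And>x y. x \<in> S \<Longrightarrow> y \<in> S \<Longrightarrow> x - y \<in> S"
    and hom: "\<And>w x y. w \<in> W \<Longrightarrow> x \<in> S \<Longrightarrow> y \<in> S \<Longrightarrow> g w (x - y) = g w x - g w y"
  shows "card S \<le> card {x \<in> S. \<forall>w\<in>W. g w x = 0} * CARD('k) ^ card W"
  using assms(1) hom
proof (induction W rule: finite_induct)
  case empty
  then show ?case by simp
next
  case (insert w W)
  let ?T = "{x \<in> S. \<forall>w\<in>W. g w x = 0}"
  have "card S \<le> card ?T * CARD('k) ^ card W"
    using insert by simp
  also have "card ?T \<le> card {x \<in> ?T. g w x = 0} * CARD('k)"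
    using insert.prems fin by (intro card_le_card_kernel) (auto simp: diff)
  also have "{x \<in> ?T. g w x = 0} = {x \<in> S. \<forall>w\<in>insert w W. g w x = 0}"
    by auto
  finally show ?case
    using insert by (simp add: mult_ac)
qed

section \<open>Dimension read off from cardinality\<close>

locale finite_scalars = vector_space scale
  for scale :: "'k::{field,finite} \<Rightarrow> 'b::ab_group_add \<Rightarrow> 'b"
begin

text \<open>A new basis vector \<open>b\<close> multiplies the size by \<open>CARD('k)\<close>: two
  representations \<open>scale k b + y\<close> of one vector with different scalars would, after
  division, put \<open>b\<close> into \<open>span B\<close>.\<close>

lemma card_span:
  assumes "finite B" "independent B"
  shows "finite (span B) \<and> card (span B) = CARD('k) ^ card B"
  using assms
proof (induction B rule: finite_induct)
  case empty
  then show ?case by simp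
next
  case (insert b B)
  then have ind: "independent B" "b \<notin> span B"
    by (simp_all add: independent_insert)
  let ?f = "\<lambda>(k, y). scale k b + y"
  have "inj_on ?f (UNIV \<times> span B)"
  proof (rule inj_onI, clarify)
    fix k y k' y'
    assume *: "y \<in> span B" "y' \<in> span B" "scale k b + y = scale k' b + y'"
    then have d: "scale (k - k') b = y' - y"
      by (simp add: scale_left_diff_distrib algebra_simps)
    then have "scale (k - k') b \<in> span B" using * by (simp add: span_diff)
    then have "scale (inverse (k - k')) (scale (k - k') b) \<in> span B" by (rule span_scale)
    then have "k = k'" using ind(2) by (cases "k = k'") auto
    with * show "k = k' \<and> y = y'" by simp
  qed
  moreover have "?f ` (UNIV \<times> span B) = span (insert b B)"
  proof safe
    fix k y assume "y \<in> span B"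
    then show "scale k b + y \<in> span (insert b B)"
      by (auto simp: span_breakdown_eq intro!: exI[of _ k])
  next
    fix x assume "x \<in> span (insert b B)"
    then obtain k where "x - scale k b \<in> span B" by (auto simp: span_breakdown_eq)
    then show "x \<in> ?f ` (UNIV \<times> span B)"
      by (intro image_eqI[of _ _ "(k, x - scale k b)"]) auto
  qed
  ultimately have "card (span (insert b B)) = card (UNIV \<times> span B :: ('k \<times> 'b) set)"
    and "finite (span (insert b B))"
    using insert ind by (metis card_image, metis finite_imageI finite_SigmaI finite)
  then show ?case using insert ind by (simp add: card_cartesian_product)
qed

lemma card_subspace:
  assumes "subspace S" "finite S"
  shows "card S = CARD('k) ^ dim S"
proof -
  obtain B where B: "B \<subseteq> S" "independent B" "S \<subseteq> span B" "card B = dim S"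
    using basis_exists by blast
  then have "span B = S" using assms(1) by (simp add: span_subspace)
  then show ?thesis using card_span[of B] B assms(2) finite_subset by metis
qed

lemma dim_eq_iff_card:
  assumes "subspace S" "finite S"
  shows "dim S = d \<longleftrightarrow> card S = CARD('k) ^ d"
proof -
  show ?thesis using card_subspace[OF assms] one_less_card_field[where 'a = 'k] by (simp add: power_inject_exp)
qed

lemma subspace_of_dim_exists:
  assumes "subspace S" "finite S" "d \<le> dim S"
  obtains T where "subspace T" "T \<subseteq> S" "dim T = d"
proof -
  obtain B where B: "B \<subseteq> S" "independent B" "S \<subseteq> span B" "card B = dim S"
    using basis_exists by blast
  obtain A where A: "A \<subseteq> B" "card A = d"
    using assms(3) B(4) obtain_subset_with_card_n by metis
  show thesis
  proof
    show "subspace (span A)" by simp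
    show "span A \<subseteq> S" using A B assms(1) by (simp add: span_minimal)
    show "dim (span A) = d" using A B independent_mono[of B A] by (simp add: dim_eq_card_independent)
  qed
qed

end

text \<open>Linearity is required on \<open>V\<close> only, because a form built from
  \<open>rel_trace\<close> is controlled only where the traces lie in \<open>range h\<close>.
  Linearity in the second argument follows from \<open>B_sym\<close>.\<close>

locale finite_pairing = finite_scalars scale
  for scale :: "'k::{field,finite} \<Rightarrow> 'b::ab_group_add \<Rightarrow> 'b" +
  fixes V :: "'b set" and B :: "'b \<Rightarrow> 'b \<Rightarrow> 'k"
  assumes finite_V: "finite V" and subspace_V: "subspace V"
    and B_add: "x \<in> V \<Longrightarrow> y \<in> V \<Longrightarrow> z \<in> V \<Longrightarrow> B (x + y) z = B x z + B y z"
    and B_scale: "x \<in> V \<Longrightarrow> z \<in> V \<Longrightarrow> B (scale c x) z = c * B x z"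
    and B_sym: "B x y = B y x"
    and B_nondegenerate: "x \<in> V \<Longrightarrow> (\<And>y. y \<in> V \<Longrightarrow> B x y = 0) \<Longrightarrow> x = 0"
begin

lemma B_zero: "z \<in> V \<Longrightarrow> B 0 z = 0"
  using B_scale[of 0 z 0] subspace_V subspace_0 by simp

lemma B_diff: 
  assumes "x \<in> V" "y \<in> V" "z \<in> V"
  shows "B (x - y) z = B x z - B y z"
  using B_add[of "x - y" y z] assms subspace_V by (simp add: subspace_diff)

section \<open>Orthogonal complements and duality\<close>

definition perp :: "'b set \<Rightarrow> 'b set" where
  "perp U = {x \<in> V. \<forall>u\<in>U. B x u = 0}"

lemma perp_subset: "perp U \<subseteq> V"
  by (auto simp: perp_def)

lemma subspace_perp: "U \<subseteq> V \<Longrightarrow> subspace (perp U)"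
  using subspace_V
  by (auto simp: perp_def subspace_def B_zero B_add B_scale subset_iff)

lemma perp_span:
  assumes "A \<subseteq> V"
  shows "perp (span A) = perp A"
proof
  show "perp (span A) \<subseteq> perp A" using span_superset by (auto simp: perp_def)
  show "perp A \<subseteq> perp (span A)"
  proof
    fix x assume x: "x \<in> perp A"
    then have "A \<subseteq> perp {x}" using assms by (auto simp: perp_def B_sym)
    then have "span A \<subseteq> perp {x}"
      using x by (intro span_minimal subspace_perp) (auto simp: perp_def)
    then show "x \<in> perp (span A)" using x by (auto simp: perp_def B_sym)
  qed
qed

text \<open>One inequality: \<open>perp U\<close> is the common kernel on \<open>V\<close> of
  \<open>dim U\<close> functionals. The other: extend a basis \<open>P\<close> of
  \<open>perp U\<close> to a basis \<open>Q\<close> of \<open>V\<close>. A vector of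
  \<open>U\<close> is orthogonal to \<open>P\<close> anyway, so if it is also orthogonal to
  \<open>Q - P\<close> it is orthogonal to all of \<open>V\<close> and vanishes; hence
  \<open>U\<close> has at most \<open>CARD('k) ^ card (Q - P)\<close> elements.\<close>

lemma card_perp:
  assumes "subspace U" "U \<subseteq> V"
  shows "card U * card (perp U) = card V"
proof (rule antisym)
  have fin: "finite U" "finite (perp U)"
    using assms(2) perp_subset finite_V finite_subset by metis+
  obtain A where A: "A \<subseteq> U" "independent A" "U \<subseteq> span A" "card A = dim U"
    using basis_exists by blast
  have "perp A = perp U"
    using perp_span[of A] span_subspace[OF A(1,3) assms(1)] A(1) assms(2) by simp
  moreover have "card V \<le> card (perp A) * CARD('k) ^ card A"
    unfolding perp_def using A(1) assms(2) finite_subset[OF A(1) fin(1)] subspace_V finite_V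
    by (intro card_le_card_common_kernel[where g = "\<lambda>w x. B x w"])
      (auto simp: subspace_diff B_diff subset_iff)
  ultimately show "card V \<le> card U * card (perp U)"
    using A(4) card_subspace[OF assms(1) fin(1)] by (simp add: mult.commute)

  obtain P where P: "P \<subseteq> perp U" "independent P" "perp U \<subseteq> span P" "card P = dim (perp U)"
    using basis_exists by blast
  obtain Q where Q: "P \<subseteq> Q" "Q \<subseteq> V" "independent Q" "V \<subseteq> span Q"
    using maximal_independent_subset_extend[of P V] P perp_subset by (metis subset_trans)
  have finQ: "finite Q" using Q(2) finite_V finite_subset by blast
  have "{u \<in> U. \<forall>w\<in>Q - P. B u w = 0} \<subseteq> {0}"
  proof clarify
    fix u assume u: "u \<in> U" "\<forall>w\<in>Q - P. B u w = 0"
    have "Q \<subseteq> perp {u}" using u P(1) Q(2) by (auto simp: perp_def B_sym)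
    then have "span Q \<subseteq> perp {u}"
      using u assms(2) by (intro span_minimal subspace_perp) auto
    then have "V \<subseteq> perp {u}" using Q(4) by blast
    then show "u = 0"
      using u(1) assms(2) by (intro B_nondegenerate) (auto simp: perp_def B_sym)
  qed
  then have "card {u \<in> U. \<forall>w\<in>Q - P. B u w = 0} \<le> 1"
    using card_mono[of "{0}" "{u \<in> U. \<forall>w\<in>Q - P. B u w = 0}"] by simp
  moreover have "card U \<le> card {u \<in> U. \<forall>w\<in>Q - P. B u w = 0} * CARD('k) ^ card (Q - P)"
    using Q(2) assms finQ fin(1)
    by (intro card_le_card_common_kernel[where g = "\<lambda>w x. B x w"])
      (auto simp: subspace_diff B_diff subset_iff)
  ultimately have "card U \<le> 1 * CARD('k) ^ card (Q - P)"
    by (meson le_trans mult_le_mono1)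
  then have "card U * card (perp U) \<le> CARD('k) ^ (card (Q - P) + card P)"
    using P(4) card_subspace[OF subspace_perp[OF assms(2)] fin(2)] by (simp add: power_add)
  also have "card (Q - P) + card P = card Q"
    using finQ Q(1) by (simp add: card_Diff_subset card_mono finite_subset)
  also have "CARD('k) ^ card Q = card V"
    using Q basis_card_eq_dim card_subspace[OF subspace_V finite_V] by metis
  finally show "card U * card (perp U) \<le> card V" .
qed

text \<open>The inclusion of \<open>U\<close> in its double complement is immediate, and applying
  \<open>card_perp\<close> twice shows that both sets have the same size.\<close>

lemma perp_perp:
  assumes "subspace U" "U \<subseteq> V"
  shows "perp (perp U) = U"
proof -
  have "card (perp U) * card (perp (perp U)) = card (perp U) * card U"
    using card_perp[OF assms] card_perp[OF subspace_perp[OF assms(2)] perp_subset]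
    by (simp add: mult.commute)
  moreover have "0 < card (perp U)"
    using card_perp[OF assms] finite_V subspace_0[OF subspace_V]
    by (metis card_gt_0_iff empty_iff mult_0_right not_gr_zero)
  moreover have "U \<subseteq> perp (perp U)"
    using assms(2) by (auto simp: perp_def B_sym)
  moreover have "finite (perp (perp U))" using perp_subset finite_V finite_subset by blast
  ultimately show ?thesis by (metis card_subset_eq mult_left_cancel not_gr_zero)
qed

lemma perp_eq_zero_iff:
  assumes "subspace U" "U \<subseteq> V"
  shows "perp U = {0} \<longleftrightarrow> U = V"
proof
  assume "perp U = {0}"
  then show "U = V"
    using perp_perp[OF assms] B_zero subspace_V by (auto simp: perp_def B_sym)
next
  assume "U = V"
  then show "perp U = {0}"
    using B_zero subspace_0[OF subspace_V] B_nondegenerate by (auto simp: perp_def)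
qed

text \<open>The complement of a sum is the intersection of the complements, so by double duality the
  sum of \<open>perp U\<close> and \<open>perp W\<close> has complement \<open>U \<inter> W\<close>;
  a subspace is all of \<open>V\<close> exactly when its complement is zero.\<close>

lemma Int_eq_zero_iff_span_perp:
  assumes "subspace U" "U \<subseteq> V" "subspace W" "W \<subseteq> V"
  shows "U \<inter> W = {0} \<longleftrightarrow> span (perp U \<union> perp W) = V"
proof -
  have sub: "perp U \<union> perp W \<subseteq> V" using perp_subset by blast
  have "perp (span (perp U \<union> perp W)) = perp (perp U) \<inter> perp (perp W)"
    unfolding perp_span[OF sub] by (auto simp: perp_def)
  also have "\<dots> = U \<inter> W" using perp_perp assms by simp
  finally show ?thesis
    using perp_eq_zero_iff[of "span (perp U \<union> perp W)"] sub subspace_V by (simp add: span_minimal)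
qed

lemma dim_perp:
  assumes "subspace U" "U \<subseteq> V"
  shows "dim U + dim (perp U) = dim V"
proof -
  have "finite U" "finite (perp U)" using assms perp_subset finite_V finite_subset by metis+
  then have "card V = CARD('k) ^ (dim U + dim (perp U))"
    using card_perp[OF assms] card_subspace assms subspace_perp by (simp add: power_add)
  then show ?thesis using dim_eq_iff_card[OF subspace_V finite_V] by metis
qed

end

section \<open>Finite subfields and the trace\<close>

text \<open>Multiplication by a nonzero \<open>x\<close> permutes \<open>F - {0}\<close>. Comparing
  the products over this set before and after, and cancelling, gives
  \<open>x ^ card (F - {0}) = 1\<close>.\<close>

lemma subfield_power_card:
  assumes "is_subfield F" "finite F" "x \<in> F"
  shows "x ^ card F = x"
proof (cases "x = 0")
  case True
  have "card F \<noteq> 0" using assms by auto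
  then show ?thesis using True by simp
next
  case False
  have mult: "a * b \<in> F" if "a \<in> F" "b \<in> F" for a b
    using assms(1) that by (simp add: is_subfield_def)
  have inv: "inverse x \<in> F" and zero: "0 \<in> F"
    using assms by (simp_all add: is_subfield_def)
  have "(\<Prod>y\<in>F - {0}. x * y) = (\<Prod>y\<in>F - {0}. y)"
    by (rule prod.reindex_bij_witness[of _ "\<lambda>y. inverse x * y" "\<lambda>y. x * y"])
      (use False assms(3) in \<open>simp_all add: mult inv flip: mult.assoc\<close>)
  then have "x ^ card (F - {0}) * (\<Prod>y\<in>F - {0}. y) = (\<Prod>y\<in>F - {0}. y)"
    by (simp add: prod.distrib)
  then have "x ^ card (F - {0}) = 1"
    using assms(2) by (simp add: prod_zero_iff)
  then have "x * x ^ card (F - {0}) = x" by simp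
  moreover have "card F = Suc (card (F - {0}))"
    using assms(2) zero by (metis card.remove)
  ultimately show ?thesis by simp
qed

section \<open>Multiplicative orders and adjoined subfields\<close>

lemma mult_order_pos:
  fixes \<alpha> :: "'l::{field,finite}"
  assumes "\<alpha> \<noteq> 0"
  shows "0 < mult_order \<alpha>" and "\<alpha> ^ mult_order \<alpha> = 1"
proof -
  have "is_subfield (UNIV :: 'l set)" by (simp add: is_subfield_def)
  then have "\<alpha> * \<alpha> ^ (CARD('l) - 1) = \<alpha>"
    using subfield_power_card[of "UNIV :: 'l set" \<alpha>] by (simp flip: power_Suc)
  then have "\<alpha> ^ (CARD('l) - 1) = 1" using assms by simp
  moreover have "0 < CARD('l) - 1"
    using one_less_card_field[where 'a = 'l] by simp
  ultimately have "\<exists>k. 0 < k \<and> \<alpha> ^ k = 1" by blast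
  then have "0 < mult_order \<alpha> \<and> \<alpha> ^ mult_order \<alpha> = 1"
    unfolding mult_order_def by (rule LeastI_ex)
  then show "0 < mult_order \<alpha>" "\<alpha> ^ mult_order \<alpha> = 1" by auto
qed

lemma power_eq_1_iff_mult_order_dvd:
  fixes \<alpha> :: "'l::{field,finite}"
  assumes "\<alpha> \<noteq> 0"
  shows "\<alpha> ^ m = 1 \<longleftrightarrow> mult_order \<alpha> dvd m"
proof -
  note ord = mult_order_pos[OF assms]
  have least: "mult_order \<alpha> \<le> k" if "0 < k" "\<alpha> ^ k = 1" for k
    unfolding mult_order_def using that by (intro Least_le) simp
  have "\<alpha> ^ m = \<alpha> ^ (m mod mult_order \<alpha>)"
    by (subst mult_div_mod_eq[symmetric, of m "mult_order \<alpha>"])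
      (simp only: power_add power_mult ord(2) power_one mult_1)
  then have "\<alpha> ^ m = 1 \<longleftrightarrow> m mod mult_order \<alpha> = 0"
    using least[of "m mod mult_order \<alpha>"] ord(1) by (metis leD mod_less_divisor not_gr_zero power_0)
  then show ?thesis by (simp add: dvd_eq_mod_eq_0)
qed

lemma power_eq_power_iff_dvd:
  fixes \<alpha> :: "'l::{field,finite}"
  assumes "\<alpha> \<noteq> 0" "i \<le> j"
  shows "\<alpha> ^ i = \<alpha> ^ j \<longleftrightarrow> mult_order \<alpha> dvd j - i"
proof -
  have "\<alpha> ^ j = \<alpha> ^ i * \<alpha> ^ (j - i)" using assms(2) by (simp flip: power_add)
  then show ?thesis using power_eq_1_iff_mult_order_dvd[OF assms(1), of "j - i"] assms(1) by auto
qed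

lemma is_subfield_adjoin: "is_subfield (adjoin h \<alpha>)"
  unfolding adjoin_def by (rule hull_in) (auto simp: is_subfield_def)

lemma generators_in_adjoin: "\<alpha> \<in> adjoin h \<alpha>" "h c \<in> adjoin h \<alpha>"
  unfolding adjoin_def by (auto intro: hull_inc)

lemma is_subfield_zero: "is_subfield F \<Longrightarrow> 0 \<in> F"
  by (simp add: is_subfield_def)

lemma is_subfield_mult: "is_subfield F \<Longrightarrow> x \<in> F \<Longrightarrow> y \<in> F \<Longrightarrow> x * y \<in> F"
  by (simp add: is_subfield_def)

lemma is_subfield_add: "is_subfield F \<Longrightarrow> x \<in> F \<Longrightarrow> y \<in> F \<Longrightarrow> x + y \<in> F"
  unfolding is_subfield_def by (metis diff_0 diff_minus_eq_add)

lemma is_subfield_power: "is_subfield F \<Longrightarrow> x \<in> F \<Longrightarrow> x ^ n \<in> F"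
  by (induction n) (simp_all add: is_subfield_def)

section \<open>Field embeddings and their action on polynomials\<close>

context field_embedding
begin

lemma hom_zero: "h 0 = 0"
  using hom_add[of 0 0] by (metis add.right_neutral add_left_cancel)

lemma hom_diff: "h (a - b) = h a - h b"
  using hom_add[of "a - b" b] by simp

lemma hom_eq_zero_iff: "h a = 0 \<longleftrightarrow> a = 0"
  by (metis hom_mult hom_one hom_zero mult_zero_left right_inverse zero_neq_one)

lemma inj_hom: "inj h"
  by (rule injI) (metis hom_diff hom_eq_zero_iff right_minus_eq)

lemma hom_inverse: "h (inverse a) = inverse (h a)"
proof (cases "a = 0")
  case False
  then have "h a * h (inverse a) = 1" by (simp add: hom_one flip: hom_mult)
  then show ?thesis by (simp add: inverse_unique)
qed (simp add: hom_zero)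

lemma is_subfield_range: "is_subfield (range h)"
  unfolding is_subfield_def
proof (intro conjI ballI)
  show "0 \<in> range h" "1 \<in> range h" using hom_zero hom_one by (metis rangeI)+
qed (auto simp flip: hom_diff hom_mult hom_inverse)

lemma map_poly_hom_add: "map_poly h (p + r) = map_poly h p + map_poly h r"
  by (rule poly_eqI) (simp add: coeff_map_poly hom_zero hom_add)

lemma map_poly_hom_smult: "map_poly h (smult c p) = smult (h c) (map_poly h p)"
  by (rule poly_eqI) (simp add: coeff_map_poly hom_zero hom_mult)

lemma map_poly_hom_pCons: "map_poly h (pCons c p) = pCons (h c) (map_poly h p)"
  by (rule poly_eqI) (simp add: coeff_map_poly hom_zero coeff_pCons split: nat.split)

lemma map_poly_hom_mult: "map_poly h (p * r) = map_poly h p * map_poly h r"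
  by (induction p) (simp_all add: map_poly_hom_add map_poly_hom_smult map_poly_hom_pCons hom_zero)

lemma map_poly_hom_const: "map_poly h [:c:] = [:h c:]"
  by (simp add: map_poly_hom_pCons)

lemma poly_in_adjoin: "poly (map_poly h p) \<alpha> \<in> adjoin h \<alpha>"
  by (induction p)
    (simp_all add: map_poly_hom_pCons is_subfield_adjoin is_subfield_add is_subfield_mult
      generators_in_adjoin is_subfield_zero)

end

section \<open>The Frobenius map and the trace\<close>

locale finite_field_embedding = field_embedding h
  for h :: "'k::{field,finite} \<Rightarrow> 'l::{field,finite}"
begin

lemma card_range_hom: "card (range h) = CARD('k)"
  by (rule card_image[OF inj_hom])

lemma one_less_q: "1 < CARD('k)"
  by (rule one_less_card_field)

lemma hom_power_q: "h c ^ CARD('k) = h c"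
  using subfield_power_card[OF is_subfield_range, of "h c"] by (simp add: card_range_hom)

text \<open>The polynomial \<open>(X + 1)^q - X^q - 1\<close> has degree below \<open>q = CARD('k)\<close> and vanishes on the small field,
  hence is zero; this avoids any appeal to the characteristic.\<close>

lemma add_power_q: "(x + y) ^ CARD('k) = x ^ CARD('k) + (y :: 'l) ^ CARD('k)"
proof (cases "y = 0")
  case True
  then show ?thesis using one_less_q by (simp add: power_0_left)
next
  case False
  define P :: "'l poly" where "P = [:1, 1:] ^ CARD('k) - monom 1 CARD('k) - 1"
  have "P = 0"
  proof (rule ccontr)
    assume P: "P \<noteq> 0"
    have deg: "degree ([:1, 1:] ^ CARD('k) :: 'l poly) = CARD('k)"
      by (simp add: degree_power_eq)
    then have "coeff ([:1, 1:] ^ CARD('k) :: 'l poly) CARD('k) = 1"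
      by (metis lead_coeff_power lead_coeff_pCons(2) lead_coeff_pCons(1) one_pCons one_neq_zero pCons_eq_0_iff power_one)
    then have "coeff P CARD('k) = 0"
      using one_less_q by (simp add: P_def)
    moreover have "degree P \<le> CARD('k)"
      unfolding P_def using deg by (intro degree_diff_le) (auto simp: degree_monom_le)
    ultimately have "degree P < CARD('k)"
      using P by (metis leading_coeff_0_iff nat_less_le)
    moreover have "range h \<subseteq> {x. poly P x = 0}"
    proof clarify
      fix c
      have "(h (1 + c)) ^ CARD('k) = h (1 + c)" by (rule hom_power_q)
      then show "poly P (h c) = 0"
        by (simp add: P_def poly_power poly_monom hom_add hom_one hom_power_q)
    qed
    then have "CARD('k) \<le> card {x. poly P x = 0}"
      by (metis card_mono card_range_hom finite)
    ultimately show False using card_poly_roots_bound[OF P] by simp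
  qed
  \<comment> \<open>The polynomial identity is the case \<open>y = 1\<close>; evaluating at the
    quotient and multiplying by the \<open>q\<close>-th power of \<open>y\<close> restores the
    general case.\<close>
  then have "poly P (x / y) = 0" by simp
  then have "(1 + x / y) ^ CARD('k) = (x / y) ^ CARD('k) + 1"
    by (simp add: P_def poly_power poly_monom algebra_simps)
  then have "y ^ CARD('k) * (1 + x / y) ^ CARD('k) = y ^ CARD('k) * ((x / y) ^ CARD('k) + 1)" by simp
  then show ?thesis
    using False by (simp add: distrib_left add.commute flip: power_mult_distrib)
qed

lemma sum_power_q: "(\<Sum>s\<in>A. f s :: 'l) ^ CARD('k) = (\<Sum>s\<in>A. f s ^ CARD('k))"
  using one_less_q by (induction A rule: infinite_finite_induct) (simp_all add: add_power_q power_0_left)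

text \<open>The elements of \<open>range h\<close> are already \<open>CARD('k)\<close> roots of
  \<open>X^q - X\<close>, as many as its degree permits, so there are no others.\<close>

lemma power_q_fixed:
  assumes "y ^ CARD('k) = (y :: 'l)"
  shows "y \<in> range h"
proof -
  define P :: "'l poly" where "P = monom 1 CARD('k) - monom 1 1"
  have P: "P \<noteq> 0"
    using one_less_q by (auto simp: P_def monom_eq_iff')
  have "degree P \<le> CARD('k)"
    unfolding P_def using one_less_q
    by (intro degree_diff_le order.trans[OF degree_monom_le]) auto
  then have "card {x. poly P x = 0} \<le> card (range h)"
    using card_poly_roots_bound[OF P] card_range_hom by simp
  moreover have "range h \<subseteq> {x. poly P x = 0}"
    by (auto simp: P_def poly_monom hom_power_q)
  ultimately have "range h = {x. poly P x = 0}"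
    by (intro card_seteq) auto
  then show ?thesis using assms by (simp add: P_def poly_monom)
qed

text \<open>The sum inside \<open>rel_trace\<close> before \<open>inv h\<close> is applied, with the
  degree as a parameter. Staying in the large field makes it additive on all of
  \<open>'l\<close>.\<close>

definition power_trace :: "nat \<Rightarrow> 'l \<Rightarrow> 'l" where
  "power_trace d x = (\<Sum>s<d. x ^ (CARD('k) ^ s))"

lemma add_power_q_power: "(x + y :: 'l) ^ (CARD('k) ^ s) = x ^ (CARD('k) ^ s) + y ^ (CARD('k) ^ s)"
  by (induction s) (simp_all add: power_mult add_power_q mult.commute[of "CARD('k)"])

lemma hom_power_q_power: "h c ^ (CARD('k) ^ s) = h c"
  by (induction s) (simp_all add: power_mult hom_power_q)

lemma power_trace_add: "power_trace d (x + y) = power_trace d x + power_trace d y"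
  by (simp add: power_trace_def add_power_q_power sum.distrib)

lemma power_trace_scale: "power_trace d (h c * x) = h c * power_trace d x"
  by (simp add: power_trace_def power_mult_distrib hom_power_q_power sum_distrib_left)

lemma power_trace_zero: "power_trace d 0 = 0"
  using power_trace_scale[of d 0 0] by (simp add: hom_zero)

text \<open>Raising to the power \<open>q\<close> shifts the summation index by one, and the new top
  term \<open>x^(q^d)\<close> equals the lost bottom term \<open>x\<close>. The trace is thus fixed
  by Frobenius.\<close>

lemma power_trace_in_range:
  assumes "is_subfield F" "card F = CARD('k) ^ d" "x \<in> F"
  shows "power_trace d x \<in> range h"
proof (rule power_q_fixed)
  have "x ^ (CARD('k) ^ d) = x"
    using subfield_power_card[OF assms(1) _ assms(3)] assms(2) by simp
  moreover have "power_trace d x ^ CARD('k) = (\<Sum>s<d. x ^ (CARD('k) ^ Suc s))"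
    by (simp add: power_trace_def sum_power_q mult.commute[of "CARD('k)"] flip: power_mult)
  moreover have "(\<Sum>s<d. x ^ (CARD('k) ^ Suc s)) + x = power_trace d x + x ^ (CARD('k) ^ d)"
    using sum.lessThan_Suc_shift[of "\<lambda>s. x ^ (CARD('k) ^ s)" d] sum.lessThan_Suc[of "\<lambda>s. x ^ (CARD('k) ^ s)" d]
    by (simp add: power_trace_def add.commute)
  ultimately show "power_trace d x ^ CARD('k) = power_trace d x" by simp
qed

text \<open>As a polynomial in \<open>x\<close> the trace is nonzero of degree at most
  \<open>q^(d-1)\<close>, fewer than the \<open>q^d\<close> elements of \<open>F\<close>, so it
  cannot vanish on all of \<open>F\<close>.\<close>

lemma power_trace_nonzero:
  assumes "is_subfield F" "card F = CARD('k) ^ d"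
  obtains x where "x \<in> F" "power_trace d x \<noteq> 0"
proof -
  \<comment> \<open>For \<open>d = 0\<close> the sum would be empty; this is excluded because a
    field has more than \<open>q^0 = 1\<close> elements.\<close>
  have "d \<noteq> 0"
  proof
    assume "d = 0"
    then obtain z where "F = {z}" using assms(2) by (auto simp: card_1_singleton_iff)
    then show False using assms(1) by (auto simp: is_subfield_def)
  qed
  then obtain e where e: "d = Suc e" by (cases d) auto
  define P :: "'l poly" where "P = (\<Sum>s<d. monom 1 (CARD('k) ^ s))"
  have "coeff P (CARD('k) ^ e) = (\<Sum>s<d. if s = e then 1 else 0)"
    unfolding P_def coeff_sum using one_less_q
    by (intro sum.cong) (auto simp: power_inject_exp)
  then have P: "P \<noteq> 0" by (auto simp: e)
  have "degree P \<le> CARD('k) ^ e"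
    unfolding P_def using one_less_q
    by (intro degree_sum_le order.trans[OF degree_monom_le]) (auto simp: e intro: power_increasing)
  also have "\<dots> < card F"
    using one_less_q by (simp add: assms(2) e)
  finally have "card {x. poly P x = 0} < card F"
    using card_poly_roots_bound[OF P] by simp
  then have "\<not> F \<subseteq> {x. poly P x = 0}"
    by (metis card_mono finite leD)
  moreover have "poly P x = power_trace d x" for x
    by (simp add: P_def power_trace_def poly_sum poly_monom)
  ultimately show thesis using that by auto
qed

text \<open>If \<open>x\<close> were invertible, \<open>x * y\<close> would run through all of
  \<open>F\<close>, including an element of nonzero trace.\<close>

lemma power_trace_nondegenerate:
  assumes "is_subfield F" "card F = CARD('k) ^ d" "x \<in> F" "\<And>y. y \<in> F \<Longrightarrow> power_trace d (x * y) = 0"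
  shows "x = 0"
proof (rule ccontr)
  assume x: "x \<noteq> 0"
  obtain z where z: "z \<in> F" "power_trace d z \<noteq> 0"
    using power_trace_nonzero[OF assms(1,2)] .
  have "inverse x * z \<in> F" using assms(1,3) z(1) by (simp add: is_subfield_def)
  then have "power_trace d (x * (inverse x * z)) = 0" by (rule assms(4))
  then show False using x z(2) by (simp add: mult.assoc[symmetric])
qed

text \<open>The values of polynomials at \<alpha> form a subring, and this ring is a field because
  in a finite field the inverse of a nonzero element is one of its powers.\<close>

lemma adjoin_eq_range_poly: "adjoin h \<alpha> = range (\<lambda>p. poly (map_poly h p) \<alpha>)"
proof
  let ?R = "range (\<lambda>p. poly (map_poly h p) \<alpha>)"
  have add: "x + y \<in> ?R" if "x \<in> ?R" "y \<in> ?R" for x y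
    using that by (auto simp: image_iff) (metis map_poly_hom_add poly_add)
  have mult: "x * y \<in> ?R" if "x \<in> ?R" "y \<in> ?R" for x y
    using that by (auto simp: image_iff) (metis map_poly_hom_mult poly_mult)
  have const: "h c \<in> ?R" for c
    by (auto simp: image_iff map_poly_hom_const intro!: exI[of _ "[:c:]"])
  have pow: "x ^ m \<in> ?R" if "x \<in> ?R" for x m
    using const[of 1] by (induction m) (simp_all add: hom_one mult that)
  have diff: "x - y \<in> ?R" if "x \<in> ?R" "y \<in> ?R" for x y
    using add[OF that(1) mult[OF const[of "- 1"] that(2)]]
    using hom_diff[of 0 1] by (simp add: hom_zero hom_one)
  have inv: "inverse x \<in> ?R" if "x \<in> ?R" for x
  proof (cases "x = 0")
    case False
    have "x ^ (mult_order x - 1) * x = 1"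
      using mult_order_pos[OF False] by (simp flip: power_Suc2)
    then show ?thesis using pow[OF that] by (metis inverse_unique mult.commute)
  qed (use that in simp)
  have "is_subfield ?R"
    unfolding is_subfield_def
  proof (intro conjI ballI)
    show "0 \<in> ?R" using const[of 0] by (simp only: hom_zero)
    show "1 \<in> ?R" using const[of 1] by (simp only: hom_one)
  qed (fact diff mult inv)+
  moreover have "\<alpha> \<in> ?R"
    by (auto simp: image_iff map_poly_hom_pCons hom_zero hom_one intro!: exI[of _ "[:0, 1:]"])
  ultimately show "adjoin h \<alpha> \<subseteq> ?R"
    unfolding adjoin_def using const by (intro hull_minimal) auto
  show "?R \<subseteq> adjoin h \<alpha>" using poly_in_adjoin by auto
qed

text \<open>A nonzero annihilating polynomial of least degree is irreducible. Some annihilator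
  exists, namely \<open>X^m - 1\<close> with \<open>m\<close> the order of \<alpha>.\<close>

lemma irreducible_annihilator_exists:
  assumes "\<alpha> \<noteq> 0"
  obtains p where "irreducible p" "poly (map_poly h p) \<alpha> = 0"
proof -
  let ?P = "\<lambda>p. p \<noteq> 0 \<and> poly (map_poly h p) \<alpha> = 0"
  define m where "m = mult_order \<alpha>"
  have m: "0 < m" "\<alpha> ^ m = 1"
    using mult_order_pos[OF assms] by (simp_all add: m_def)
  have "map_poly h (monom 1 m + [:- 1:]) = monom 1 m + [:- 1:]"
    using hom_diff[of 0 1]
    by (simp add: map_poly_hom_add map_poly_hom_const map_poly_monom hom_zero hom_one)
  then have "poly (map_poly h (monom 1 m + [:- 1:])) \<alpha> = 0"
    using m by (simp add: poly_monom)
  moreover have "coeff (monom 1 m + [:- 1:] :: 'k poly) m = 1"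
    using m(1) by (simp add: coeff_pCons split: nat.split)
  then have "monom 1 m + [:- 1:] \<noteq> (0 :: 'k poly)"
    by (metis coeff_0 zero_neq_one)
  ultimately have "\<exists>p. ?P p" by blast
  then obtain p where p: "?P p" and min: "\<And>r. ?P r \<Longrightarrow> degree p \<le> degree r"
    using ex_has_least_nat[of ?P _ degree] by metis
  have "irreducible p"
  proof (rule irreducibleI)
    show "p \<noteq> 0" using p by simp
    show "\<not> p dvd 1"
    proof
      assume "p dvd 1"
      then obtain r where r: "1 = p * r" by (rule dvdE)
      have "map_poly h 1 = (1 :: 'l poly)"
        using map_poly_hom_const[of 1] by (simp add: hom_one one_pCons)
      then show False
        using p r map_poly_hom_mult[of p r] by (metis mult_zero_left one_neq_zero poly_1 poly_mult)
    qed
    fix a b assume ab: "p = a * b"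
    \<comment> \<open>A factor that still annihilates \<alpha> has at least the degree of
      \<open>p\<close>, so its cofactor is a nonzero constant.\<close>
    have unit: "c dvd 1" if "p = a' * c" "?P a'" for a' c
    proof -
      have "c \<noteq> 0" using that p by auto
      then have "degree p = degree a' + degree c" using that by (simp add: degree_mult_eq)
      then have "degree c = 0" using min[OF that(2)] by simp
      then show ?thesis using \<open>c \<noteq> 0\<close> by (simp add: is_unit_iff_degree)
    qed
    have "a \<noteq> 0" "b \<noteq> 0" using ab p by auto
    moreover have "poly (map_poly h a) \<alpha> = 0 \<or> poly (map_poly h b) \<alpha> = 0"
      using p ab by (simp add: map_poly_hom_mult)
    ultimately show "a dvd 1 \<or> b dvd 1"
      using unit[of a b] unit[of b a] ab by (metis mult.commute)
  qed
  then show thesis using p that by blast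
qed

end

section \<open>The trace form\<close>

lemma conjugate_over_sym: "conjugate_over h \<alpha> \<beta> \<Longrightarrow> conjugate_over h \<beta> \<alpha>"
  by (auto simp: conjugate_over_def)

context finite_field_embedding
begin

text \<open>By linearity, vanishing at all powers gives vanishing at all polynomial values. In the
  induction the factor \<open>X\<close> of \<open>pCons c p\<close> is absorbed into the
  coefficients \<beta>, which shifts \<open>i\<close> to \<open>Suc i\<close>; hence these are kept
  arbitrary.\<close>

lemma power_trace_poly:
  assumes "\<And>i. power_trace d1 (\<beta>1 * \<alpha>1 ^ i) + power_trace d2 (\<beta>2 * \<alpha>2 ^ i) = 0"
  shows "power_trace d1 (\<beta>1 * poly (map_poly h p) \<alpha>1)
    + power_trace d2 (\<beta>2 * poly (map_poly h p) \<alpha>2) = 0"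
  using assms
proof (induction p arbitrary: \<beta>1 \<beta>2)
  case 0
  then show ?case by (simp add: power_trace_zero)
next
  case (pCons c p)
  have split: "power_trace d (\<beta> * poly (map_poly h (pCons c p)) \<alpha>)
      = h c * power_trace d \<beta> + power_trace d (\<beta> * \<alpha> * poly (map_poly h p) \<alpha>)" for d \<alpha> \<beta>
    by (simp add: map_poly_hom_pCons distrib_left power_trace_add mult_ac
        flip: power_trace_scale)
  have "power_trace d1 (\<beta>1 * \<alpha>1 * \<alpha>1 ^ i) + power_trace d2 (\<beta>2 * \<alpha>2 * \<alpha>2 ^ i) = 0" for i
    using pCons.prems[of "Suc i"] by (simp add: mult.assoc)
  then have "power_trace d1 (\<beta>1 * \<alpha>1 * poly (map_poly h p) \<alpha>1)
      + power_trace d2 (\<beta>2 * \<alpha>2 * poly (map_poly h p) \<alpha>2) = 0"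
    by (rule pCons.IH)
  moreover have "h c * power_trace d1 \<beta>1 + h c * power_trace d2 \<beta>2 = 0"
    using pCons.prems[of 0] by (simp flip: distrib_left)
  ultimately show ?case unfolding split by (simp add: algebra_simps)
qed

text \<open>Multiplying by the minimal polynomial of \<open>\<alpha>2\<close> removes the second trace, and leaves a
  nonzero multiple of \<open>\<beta>1\<close> because \<open>\<alpha>1\<close> is not a root of that polynomial.\<close>

lemma trace_sum_eq_zeroD:
  assumes "\<alpha>2 \<noteq> 0" "\<not> conjugate_over h \<alpha>1 \<alpha>2"
    and "card (adjoin h \<alpha>1) = CARD('k) ^ d1" "\<beta>1 \<in> adjoin h \<alpha>1"
    and "\<And>i. power_trace d1 (\<beta>1 * \<alpha>1 ^ i) + power_trace d2 (\<beta>2 * \<alpha>2 ^ i) = 0"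
  shows "\<beta>1 = 0"
proof -
  obtain p where p: "irreducible p" "poly (map_poly h p) \<alpha>2 = 0"
    using irreducible_annihilator_exists[OF assms(1)] .
  then have p1: "poly (map_poly h p) \<alpha>1 \<noteq> 0"
    using assms(2) by (auto simp: conjugate_over_def)
  have "\<beta>1 * poly (map_poly h p) \<alpha>1 = 0"
  proof (rule power_trace_nondegenerate[OF is_subfield_adjoin assms(3)])
    show "\<beta>1 * poly (map_poly h p) \<alpha>1 \<in> adjoin h \<alpha>1"
      using assms(4) poly_in_adjoin is_subfield_adjoin is_subfield_mult by metis
    \<comment> \<open>Write \<open>y\<close> as the value of \<open>r\<close> at the first generator
      and use \<open>p * r\<close>: its value at the second generator is zero because
      \<open>p\<close> vanishes there.\<close>
    fix y assume "y \<in> adjoin h \<alpha>1"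
    then obtain r where "y = poly (map_poly h r) \<alpha>1"
      by (auto simp: adjoin_eq_range_poly)
    then show "power_trace d1 (\<beta>1 * poly (map_poly h p) \<alpha>1 * y) = 0"
      using power_trace_poly[where p = "p * r", OF assms(5)] p(2)
      by (simp add: map_poly_hom_mult power_trace_zero mult.assoc)
  qed
  then show ?thesis using p1 by simp
qed

text \<open>The number of summands in \<open>rel_trace\<close> is a dimension, which the size of
  \<open>F\<close> identifies as \<open>d\<close>; \<open>h\<close> then cancels
  \<open>inv h\<close> because the sum lies in \<open>range h\<close>.\<close>

lemma hom_rel_trace:
  assumes "is_subfield F" "range h \<subseteq> F" "card F = CARD('k) ^ d" "x \<in> F"
  shows "h (rel_trace h F x) = power_trace d x"
proof -
  interpret ext: finite_scalars "ext_scale h"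
    by (simp add: finite_scalars_def vector_space_ext_scale)
  have "ext.subspace F"
    using assms(1,2)
    by (auto simp: ext.subspace_def ext_scale_def is_subfield_zero is_subfield_add is_subfield_mult subset_iff)
  then have "ext.dim F = d"
    using ext.dim_eq_iff_card[of F d] assms(3) by simp
  then have "rel_trace h F x = inv h (power_trace d x)"
    by (simp add: rel_trace_def power_trace_def)
  then show ?thesis
    using power_trace_in_range[OF assms(1,3,4)] by (simp add: f_inv_into_f)
qed

definition trace_form :: "'l set \<Rightarrow> 'l set \<Rightarrow> 'l \<times> 'l \<Rightarrow> 'l \<times> 'l \<Rightarrow> 'k" where
  "trace_form F1 F2 x y = rel_trace h F1 (fst x * fst y) + rel_trace h F2 (snd x * snd y)"

lemma hom_trace_form:
  assumes "is_subfield F1" "range h \<subseteq> F1" "card F1 = CARD('k) ^ d1"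
    and "is_subfield F2" "range h \<subseteq> F2" "card F2 = CARD('k) ^ d2"
    and "x \<in> F1 \<times> F2" "y \<in> F1 \<times> F2"
  shows "h (trace_form F1 F2 x y)
    = power_trace d1 (fst x * fst y) + power_trace d2 (snd x * snd y)"
  using assms
  by (auto simp: trace_form_def hom_add hom_rel_trace[where d = d1] hom_rel_trace[where d = d2] is_subfield_mult)

text \<open>Linearity is checked after applying the injective \<open>h\<close>. For nondegeneracy,
  test vectors with one zero component separate the two traces.\<close>

lemma finite_pairing_trace_form:
  assumes F1: "is_subfield F1" "range h \<subseteq> F1" "card F1 = CARD('k) ^ d1"
    and F2: "is_subfield F2" "range h \<subseteq> F2" "card F2 = CARD('k) ^ d2"
  shows "finite_pairing (pair_scale h) (F1 \<times> F2) (trace_form F1 F2)"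
proof -
  interpret pair: vector_space "pair_scale h" by (rule vector_space_pair_scale)
  note hom = hom_trace_form[OF F1 F2]
  have sub: "pair.subspace (F1 \<times> F2)"
    using F1(1,2) F2(1,2)
    by (auto simp: pair.subspace_def pair_scale_def zero_prod_def is_subfield_zero is_subfield_add
        is_subfield_mult subset_iff)
  show ?thesis
  proof
    show "finite (F1 \<times> F2)" by simp
    show "pair.subspace (F1 \<times> F2)" by (rule sub)
  next
    fix x y z assume "x \<in> F1 \<times> F2" "y \<in> F1 \<times> F2" "z \<in> F1 \<times> F2"
    moreover from this have "x + y \<in> F1 \<times> F2" using sub pair.subspace_add by blast
    ultimately have "h (trace_form F1 F2 (x + y) z) = h (trace_form F1 F2 x z + trace_form F1 F2 y z)"
      by (simp add: hom hom_add power_trace_add distrib_right del: mem_Times_iff)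
    then show "trace_form F1 F2 (x + y) z = trace_form F1 F2 x z + trace_form F1 F2 y z"
      by (rule injD[OF inj_hom])
  next
    fix x z c assume "x \<in> F1 \<times> F2" "z \<in> F1 \<times> F2"
    moreover from this have "pair_scale h c x \<in> F1 \<times> F2" using sub pair.subspace_scale by blast
    ultimately have "h (trace_form F1 F2 (pair_scale h c x) z) = h (c * trace_form F1 F2 x z)"
      by (simp add: hom hom_mult distrib_left pair_scale_def mult.assoc power_trace_scale
          del: mem_Times_iff)
    then show "trace_form F1 F2 (pair_scale h c x) z = c * trace_form F1 F2 x z"
      by (rule injD[OF inj_hom])
  next
    fix x y show "trace_form F1 F2 x y = trace_form F1 F2 y x"
      by (simp add: trace_form_def mult.commute)
  next
    fix x assume x: "x \<in> F1 \<times> F2" and orth: "\<And>y. y \<in> F1 \<times> F2 \<Longrightarrow> trace_form F1 F2 x y = 0"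
    have orth': "power_trace d1 (fst x * a) + power_trace d2 (snd x * b) = 0"
      if "a \<in> F1" "b \<in> F2" for a b
      using hom[OF x, of "(a, b)"] orth[of "(a, b)"] that by (simp add: hom_zero)
    have "fst x = 0"
    proof (rule power_trace_nondegenerate[OF F1(1,3)])
      show "fst x \<in> F1" using x by auto
      show "power_trace d1 (fst x * y) = 0" if "y \<in> F1" for y
        using orth'[OF that is_subfield_zero[OF F2(1)]] by (simp add: power_trace_zero)
    qed
    moreover have "snd x = 0"
    proof (rule power_trace_nondegenerate[OF F2(1,3)])
      show "snd x \<in> F2" using x by auto
      show "power_trace d2 (snd x * y) = 0" if "y \<in> F2" for y
        using orth'[OF is_subfield_zero[OF F1(1)] that] by (simp add: power_trace_zero)
    qed
    ultimately show "x = 0" by (simp add: prod_eq_iff)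
  qed
qed

end

section \<open>Codes obtained by evaluating a form\<close>

lemma Min_image_diff_nat:
  fixes N :: "nat set"
  assumes "finite N" "N \<noteq> {}"
  shows "Min ((\<lambda>m. n - m) ` N) = n - Max N"
  using assms by (intro Min_eqI) (auto intro!: diff_le_mono2)

text \<open>The code in abstract form: words list the values of the pairing at the points
  \<open>g i\<close>, and \<open>separating\<close> is what makes the encoding injective.\<close>

locale evaluation_code = finite_pairing scale V B
  for scale :: "'k::{field,finite} \<Rightarrow> 'b::ab_group_add \<Rightarrow> 'b" and V B +
  fixes g :: "nat \<Rightarrow> 'b" and n :: nat
  assumes point_in_V: "g i \<in> V"
    and separating: "x \<in> V \<Longrightarrow> (\<And>i. i < n \<Longrightarrow> B x (g i) = 0) \<Longrightarrow> x = 0"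
begin

sublocale word: vector_space word_scale
  by (rule vector_space_word_scale)

definition ev :: "'b \<Rightarrow> nat \<Rightarrow> 'k" where
  "ev x = (\<lambda>i. if i < n then B x (g i) else 0)"

lemma ev_add: "x \<in> V \<Longrightarrow> y \<in> V \<Longrightarrow> ev (x + y) = ev x + ev y"
  by (auto simp: ev_def B_add point_in_V)

lemma ev_scale: "x \<in> V \<Longrightarrow> ev (scale c x) = word_scale c (ev x)"
  by (auto simp: ev_def B_scale point_in_V word_scale_def)

lemma ev_zero: "ev 0 = 0"
  by (auto simp: ev_def B_zero point_in_V)

lemma inj_on_ev: "inj_on ev V"
proof (rule inj_onI)
  fix x y assume xy: "x \<in> V" "y \<in> V" "ev x = ev y"
  have "B (x - y) (g i) = 0" if "i < n" for i
    using fun_cong[OF xy(3), of i] that xy(1,2) by (simp add: ev_def B_diff point_in_V)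
  then show "x = y"
    using separating[of "x - y"] xy subspace_V by (simp add: subspace_diff)
qed

lemma word_subspace_image:
  assumes "subspace U" "U \<subseteq> V"
  shows "word.subspace (ev ` U)"
  unfolding word.subspace_def
proof (intro conjI ballI allI)
  show "0 \<in> ev ` U" using assms(1) ev_zero by (metis imageI subspace_0)
next
  fix v w assume "v \<in> ev ` U" "w \<in> ev ` U"
  then obtain x y where "x \<in> U" "y \<in> U" "v = ev x" "w = ev y" by blast
  then have "v + w = ev (x + y)" "x + y \<in> U"
    using assms by (auto simp: ev_add subspace_add subset_iff)
  then show "v + w \<in> ev ` U" by blast
next
  fix c v assume "v \<in> ev ` U"
  then obtain x where "x \<in> U" "v = ev x" by blast
  then have "word_scale c v = ev (scale c x)" "scale c x \<in> U"
    using assms by (auto simp: ev_scale subspace_scale)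
  then show "word_scale c v \<in> ev ` U" by blast
qed

text \<open>\<open>ev\<close> is injective on \<open>V\<close>, so \<open>U\<close> and its image
  have the same size, and over a common finite field size determines dimension.\<close>

lemma word_dim_image:
  assumes "subspace U" "U \<subseteq> V"
  shows "word.dim (ev ` U) = dim U"
proof -
  interpret fw: finite_scalars word_scale by unfold_locales
  have fin: "finite U" using assms(2) finite_V finite_subset by blast
  have "card (ev ` U) = card U"
    using inj_on_subset[OF inj_on_ev assms(2)] by (rule card_image)
  then show ?thesis
    using fw.dim_eq_iff_card[OF word_subspace_image[OF assms], of "dim U"]
      card_subspace[OF assms(1) fin] fin by simp
qed

lemma subspace_of_codewords:
  assumes "word.subspace D" "D \<subseteq> ev ` V"
  obtains U where "subspace U" "U \<subseteq> V" "D = ev ` U"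
proof
  let ?U = "{x \<in> V. ev x \<in> D}"
  show "subspace ?U"
    using subspace_V assms(1)
    by (auto simp: subspace_def word.subspace_def ev_zero ev_add ev_scale)
  show "D = ev ` ?U" using assms(2) by auto
qed auto

lemma image_Int_eq_zero_iff:
  assumes "subspace U" "U \<subseteq> V" "subspace W" "W \<subseteq> V"
  shows "ev ` U \<inter> ev ` W = {0} \<longleftrightarrow> U \<inter> W = {0}"
proof -
  have "ev ` U \<inter> ev ` W = ev ` (U \<inter> W)"
    using inj_on_image_Int[OF inj_on_ev assms(2,4)] by simp
  moreover have "ev ` (U \<inter> W) = ev ` {0} \<longleftrightarrow> U \<inter> W = {0}"
    using assms(2) subspace_0[OF subspace_V] by (intro inj_on_image_eq_iff[OF inj_on_ev]) auto
  ultimately show ?thesis by (simp add: ev_zero)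
qed

text \<open>A position below \<open>n\<close> lies outside the support exactly when every vector of
  \<open>U\<close> is orthogonal to \<open>g i\<close>.\<close>

lemma card_Supp_image:
  assumes "U \<subseteq> V"
  shows "card (Supp (ev ` U)) = n - card {i. i < n \<and> g i \<in> perp U}"
proof -
  have "Supp (ev ` U) = {..<n} - {i. i < n \<and> g i \<in> perp U}"
    using point_in_V by (auto simp: Supp_def ev_def perp_def B_sym)
  moreover have "card ({..<n} - {i. i < n \<and> g i \<in> perp U}) = card {..<n} - card {i. i < n \<and> g i \<in> perp U}"
    by (rule card_Diff_subset) auto
  ultimately show ?thesis by simp
qed

text \<open>The map sending a subspace to its complement matches the admissible subcodes with the
  admissible \<open>H\<close>, and support size becomes \<open>n\<close> minus the number of points
  in \<open>H\<close>. The given \<open>U\<close> ensures that minimum and maximum range over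
  nonempty sets.\<close>

lemma rel_gen_hamming_weight_eq:
  assumes W: "subspace W" "W \<subseteq> V"
    and U: "subspace U" "U \<subseteq> V" "U \<inter> W = {0}" "dim U = j"
  shows "int (rel_gen_hamming_weight j (ev ` V) (ev ` W)) = int n -
    int (Max {card {i. i < n \<and> g i \<in> H} | H. H \<subseteq> V \<and> subspace H \<and> dim H = dim V - j \<and>
      span (H \<union> perp W) = V})"
    (is "_ = int n - int (Max ?N)")
proof -
  let ?M = "{card (Supp D) | D. D \<subseteq> ev ` V \<and> word.subspace D \<and> word.dim D = j \<and>
    D \<inter> ev ` W = {0}}"
  have fromU: "n - card {i. i < n \<and> g i \<in> perp U'} \<in> ?M \<and> card {i. i < n \<and> g i \<in> perp U'} \<in> ?N"
    if U': "subspace U'" "U' \<subseteq> V" "U' \<inter> W = {0}" "dim U' = j" for U'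
  proof
    have "ev ` U' \<subseteq> ev ` V" using U'(2) by blast
    moreover have "ev ` U' \<inter> ev ` W = {0}" using image_Int_eq_zero_iff U' W by blast
    ultimately show "n - card {i. i < n \<and> g i \<in> perp U'} \<in> ?M"
      using word_subspace_image[OF U'(1,2)] word_dim_image[OF U'(1,2)] card_Supp_image[OF U'(2)] U'(4)
      by (intro CollectI exI[of _ "ev ` U'"]) simp
    have "dim (perp U') = dim V - j" using dim_perp[OF U'(1,2)] U'(4) by simp
    moreover have "span (perp U' \<union> perp W) = V"
      using Int_eq_zero_iff_span_perp[OF U'(1,2) W] U'(3) by simp
    ultimately show "card {i. i < n \<and> g i \<in> perp U'} \<in> ?N"
      using subspace_perp[OF U'(2)] perp_subset by blast
  qed
  have M_iff: "?M = (\<lambda>m. n - m) ` ?N"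
  proof (intro equalityI subsetI)
    fix m assume "m \<in> ?M"
    then obtain D where D: "m = card (Supp D)" "D \<subseteq> ev ` V" "word.subspace D" "word.dim D = j"
      "D \<inter> ev ` W = {0}" by blast
    obtain U' where U': "subspace U'" "U' \<subseteq> V" "D = ev ` U'"
      using subspace_of_codewords[OF D(3,2)] .
    have "U' \<inter> W = {0}" using image_Int_eq_zero_iff[OF U'(1,2) W] D(5) U'(3) by simp
    moreover have "dim U' = j" using word_dim_image[OF U'(1,2)] D(4) U'(3) by simp
    ultimately have "card {i. i < n \<and> g i \<in> perp U'} \<in> ?N" using fromU U'(1,2) by blast
    moreover have "m = n - card {i. i < n \<and> g i \<in> perp U'}"
      using card_Supp_image[OF U'(2)] D(1) U'(3) by simp
    ultimately show "m \<in> (\<lambda>m. n - m) ` ?N" by (rule rev_image_eqI)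
  next
    fix m assume "m \<in> (\<lambda>m. n - m) ` ?N"
    then obtain H where H: "m = n - card {i. i < n \<and> g i \<in> H}" "H \<subseteq> V" "subspace H"
      "dim H = dim V - j" "span (H \<union> perp W) = V" by blast
    have HH: "perp (perp H) = H" using perp_perp[OF H(3,2)] .
    \<comment> \<open>This makes the natural subtraction \<open>dim V - j\<close> exact, so that
      \<open>perp H\<close> has dimension \<open>j\<close>.\<close>
    have "j \<le> dim V" using dim_perp[OF U(1,2)] U(4) by simp
    then have "dim (perp H) = j" using dim_perp[OF H(3,2)] H(4) by simp
    moreover have "perp H \<inter> W = {0}"
      using Int_eq_zero_iff_span_perp[OF subspace_perp[OF H(2)] perp_subset W] HH H(5) by simp
    ultimately show "m \<in> ?M"
      using fromU[OF subspace_perp[OF H(2)] perp_subset] HH H(1) by simp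
  qed
  \<comment> \<open>The bound makes \<open>?N\<close> finite and lets the truncated difference
    \<open>n - Max ?N\<close> pass to integers.\<close>
  have le: "m \<le> n" if m: "m \<in> ?N" for m
  proof -
    obtain H where "m = card {i. i < n \<and> g i \<in> H}" using m by blast
    moreover have "card {i. i < n \<and> g i \<in> H} \<le> card {..<n}" by (rule card_mono) auto
    ultimately show ?thesis by simp
  qed
  then have "?N \<subseteq> {..n}" by (intro subsetI) simp
  then have fin: "finite ?N" by (rule finite_subset) simp
  have ne: "?N \<noteq> {}" using fromU[OF U] by blast
  have "Min ((\<lambda>m. n - m) ` ?N) = n - Max ?N"
    using fin ne by (rule Min_image_diff_nat)
  then have "rel_gen_hamming_weight j (ev ` V) (ev ` W) = n - Max ?N"
    unfolding rel_gen_hamming_weight_def M_iff .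
  moreover have "Max ?N \<le> n" using le Max_in[OF fin ne] by blast
  ultimately show ?thesis by (simp add: of_nat_diff)
qed

end

section \<open>The two-zero cyclic code\<close>

text \<open>Two exponents give the same point iff both orders, hence their lcm \<open>n\<close>,
  divide the difference. So exponents below \<open>n\<close> give distinct points, and moving the
  range from \<open>1..n\<close> to \<open>0..n-1\<close> only trades exponent \<open>n\<close> for
  \<open>0\<close>.\<close>

lemma card_Int_cyclic:
  fixes \<alpha>1 \<alpha>2 :: "'l::{field,finite}"
  assumes "\<alpha>1 \<noteq> 0" "\<alpha>2 \<noteq> 0" and n: "n = lcm (mult_order \<alpha>1) (mult_order \<alpha>2)"
  shows "card (H \<inter> {(\<alpha>1 ^ i, \<alpha>2 ^ i) | i. 1 \<le> i \<and> i \<le> n}) = card {i. i < n \<and> (\<alpha>1 ^ i, \<alpha>2 ^ i) \<in> H}"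
proof -
  let ?g = "\<lambda>i. (\<alpha>1 ^ i, \<alpha>2 ^ i)"
  have pos: "0 < n"
    unfolding n using mult_order_pos(1) assms(1,2) by (intro lcm_pos_nat) auto
  have period: "?g n = ?g 0"
    using power_eq_1_iff_mult_order_dvd[OF assms(1), of n] power_eq_1_iff_mult_order_dvd[OF assms(2), of n]
    by (simp add: n)
  have eqD: "i = j" if "i \<le> j" "j < n" "?g i = ?g j" for i j
  proof -
    have "n dvd j - i"
      using that power_eq_power_iff_dvd[OF assms(1) that(1)] power_eq_power_iff_dvd[OF assms(2) that(1)]
      by (simp add: n)
    then show ?thesis using that by (auto dest: dvd_imp_le)
  qed
  have inj: "inj_on ?g {i. i < n \<and> ?g i \<in> H}"
  proof (rule inj_onI)
    fix i j assume "i \<in> {i. i < n \<and> ?g i \<in> H}" "j \<in> {i. i < n \<and> ?g i \<in> H}" "?g i = ?g j"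
    then show "i = j" using eqD[of i j] eqD[of j i] by (cases "i \<le> j") auto
  qed
  have "?g ` {i. i < n \<and> ?g i \<in> H} = H \<inter> {?g i | i. 1 \<le> i \<and> i \<le> n}"
  proof (intro equalityI subsetI)
    fix x assume "x \<in> ?g ` {i. i < n \<and> ?g i \<in> H}"
    then obtain i where i: "i < n" "x = ?g i" "x \<in> H" by blast
    define i' where "i' = (if i = 0 then n else i)"
    have "x = ?g i'" "1 \<le> i'" "i' \<le> n" using i pos period by (auto simp: i'_def)
    then show "x \<in> H \<inter> {?g i | i. 1 \<le> i \<and> i \<le> n}" using i(3) by blast
  next
    fix x assume "x \<in> H \<inter> {?g i | i. 1 \<le> i \<and> i \<le> n}"
    then obtain i where i: "1 \<le> i" "i \<le> n" "x = ?g i" "x \<in> H" by blast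
    define i' where "i' = (if i = n then 0 else i)"
    have "x = ?g i'" "i' < n" using i pos period by (auto simp: i'_def)
    then show "x \<in> ?g ` {i. i < n \<and> ?g i \<in> H}" using i(4) by blast
  qed
  then show ?thesis using card_image[OF inj] by simp
qed

theorem theorem2p1:
  fixes h :: "'k::{field,finite} \<Rightarrow> 'l::{field,finite}"
    and \<alpha>1 \<alpha>2 :: 'l
    and F1 F2 :: "'l set"
    and n1 n2 n k1 k2 j :: nat
    and C C' :: "(nat \<Rightarrow> 'k) set"
  assumes "field_embedding h"
    and "\<alpha>1 \<noteq> 0" and "\<alpha>2 \<noteq> 0"
    and "\<not> conjugate_over h \<alpha>1 \<alpha>2"
    and "n1 = mult_order \<alpha>1" and "n2 = mult_order \<alpha>2"
    and "F1 = adjoin h \<alpha>1" and "F2 = adjoin h \<alpha>2"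
    and "card F1 = CARD('k) ^ k1" and "card F2 = CARD('k) ^ k2"
    and "n = n1 * n2 div gcd n1 n2"
    and "C = {codeword h \<alpha>1 \<alpha>2 n \<beta>1 \<beta>2 | \<beta>1 \<beta>2. \<beta>1 \<in> F1 \<and> \<beta>2 \<in> F2}"
    and "C' = {codeword h \<alpha>1 \<alpha>2 n 0 \<beta>2 | \<beta>2. \<beta>2 \<in> F2}"
    and "1 \<le> j" and "j \<le> k1"
  shows "int (rel_gen_hamming_weight j C C') = int n -
    int (Max {card (H \<inter> {(\<alpha>1 ^ i, \<alpha>2 ^ i) | i. 1 \<le> i \<and> i \<le> n}) | H.
      H \<subseteq> F1 \<times> F2 \<and> module.subspace (pair_scale h) H \<and>
      vector_space.dim (pair_scale h) H = k1 + k2 - j \<and> snd ` H = F2})"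
proof -
  interpret finite_field_embedding h
    using assms(1) by (simp add: finite_field_embedding_def)
  let ?g = "\<lambda>i. (\<alpha>1 ^ i, \<alpha>2 ^ i)"
  let ?B = "trace_form F1 F2"
  let ?V = "F1 \<times> F2" and ?W = "{0 :: 'l} \<times> F2" and ?Y = "F1 \<times> {0 :: 'l}"
  have n: "n = lcm (mult_order \<alpha>1) (mult_order \<alpha>2)"
    using assms(5,6,11) by (simp add: lcm_nat_def)
  have F1: "is_subfield F1" "range h \<subseteq> F1" "card F1 = CARD('k) ^ k1"
    and F2: "is_subfield F2" "range h \<subseteq> F2" "card F2 = CARD('k) ^ k2"
    using assms(7-10) by (auto simp: is_subfield_adjoin generators_in_adjoin)
  note zero = is_subfield_zero[OF F1(1)] is_subfield_zero[OF F2(1)]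
  note hom_form = hom_trace_form[OF F1 F2]
  have points: "?g i \<in> ?V" for i
    using assms(7,8) by (auto intro: is_subfield_power is_subfield_adjoin generators_in_adjoin)
  have "0 < n" unfolding n using mult_order_pos(1) assms(2,3) by (intro lcm_pos_nat) auto
  interpret evaluation_code "pair_scale h" ?V ?B ?g n
  proof (intro evaluation_code.intro evaluation_code_axioms.intro)
    show "finite_pairing (pair_scale h) ?V ?B" by (rule finite_pairing_trace_form[OF F1 F2])
    show "?g i \<in> ?V" for i by (rule points)
    fix x assume x: "x \<in> ?V" and orth: "\<And>i. i < n \<Longrightarrow> ?B x (?g i) = 0"
    \<comment> \<open>Orthogonality is given for one period only, while
      \<open>trace_sum_eq_zeroD\<close> needs every exponent; both orders divide \<open>n\<close>,
      so the points repeat.\<close>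
    have period: "?g i = ?g (i mod n)" for i
    proof -
      have "mult_order \<alpha> dvd i - i mod n" if "mult_order \<alpha> dvd n" for \<alpha> :: 'l
        using that by (metis dvd_trans dvd_minus_mod)
      then show ?thesis
        using power_eq_power_iff_dvd[of \<alpha>1 "i mod n" i] power_eq_power_iff_dvd[of \<alpha>2 "i mod n" i]
          assms(2,3) by (simp add: n)
    qed
    have sum: "power_trace k1 (fst x * \<alpha>1 ^ i) + power_trace k2 (snd x * \<alpha>2 ^ i) = 0" for i
    proof -
      have "?B x (?g i) = 0"
        unfolding period[of i] using \<open>0 < n\<close> by (intro orth) simp
      then show ?thesis using hom_form[OF x points[of i]] by (simp add: hom_zero)
    qed
    have "fst x = 0"
      using trace_sum_eq_zeroD[OF assms(3,4) _ _ sum] F1(3) x assms(7) by auto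
    \<comment> \<open>Non-conjugacy is symmetric, so the same lemma applies with the two summands
      exchanged.\<close>
    moreover have "\<not> conjugate_over h \<alpha>2 \<alpha>1"
      using assms(4) conjugate_over_sym by blast
    then have "snd x = 0"
      using trace_sum_eq_zeroD[OF assms(2) _ _ _ sum[unfolded add.commute[of "power_trace k1 _"]]]
        F2(3) x assms(8) by auto
    ultimately show "x = 0" by (simp add: prod_eq_iff)
  qed
  have codeword: "codeword h \<alpha>1 \<alpha>2 n a b = ev (a, b)" for a b
    by (intro ext) (simp add: codeword_def ev_def trace_form_def flip: assms(7,8))
  have C: "C = ev ` ?V" "C' = ev ` ?W"
    unfolding assms(12,13) codeword by blast+
  have W: "subspace ?W" "?W \<subseteq> ?V" and Y: "subspace ?Y" "?Y \<subseteq> ?V"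
    using F1(1) F2(1) zero subsetD[OF F1(2) rangeI] subsetD[OF F2(2) rangeI]
    by (auto simp: subspace_def pair_scale_def zero_prod_def is_subfield_add is_subfield_mult)
  have dim_V: "dim ?V = k1 + k2" and dim_Y: "dim ?Y = k1"
    using dim_eq_iff_card[OF subspace_V] dim_eq_iff_card[OF Y(1)]
    by (simp_all add: card_cartesian_product F1(3) F2(3) power_add)
  \<comment> \<open>Pairing with \<open>(0, b)\<close> sees only the second trace, which is
    nondegenerate on \<open>F2\<close>.\<close>
  have perp_W: "perp ?W = ?Y"
  proof (intro equalityI subsetI)
    fix x assume x: "x \<in> perp ?W"
    have orth: "power_trace k2 (snd x * b) = 0" if "b \<in> F2" for b
      using x that hom_form[of x "(0, b)"] zero by (auto simp: perp_def hom_zero power_trace_zero)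
    have "snd x \<in> F2" using x by (auto simp: perp_def)
    then have "snd x = 0" using orth by (rule power_trace_nondegenerate[OF F2(1,3)])
    then show "x \<in> ?Y" using x by (auto simp: perp_def)
  next
    fix x assume x: "x \<in> ?Y"
    have "h (?B x y) = 0" if "y \<in> ?W" for y
      using x that hom_form[of x y] zero by (auto simp: power_trace_zero)
    then show "x \<in> perp ?W" using x zero by (auto simp: perp_def hom_eq_zero_iff)
  qed
  \<comment> \<open>Modulo \<open>?Y\<close> a vector is determined by its second component, so
    \<open>H\<close> and \<open>?Y\<close> together fill \<open>?V\<close> exactly when
    \<open>H\<close> projects onto \<open>F2\<close>.\<close>
  have span_iff: "span (H \<union> ?Y) = ?V \<longleftrightarrow> snd ` H = F2" if H: "H \<subseteq> ?V" "subspace H" for H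
  proof -
    have "span (H \<union> ?Y) = {x + y | x y. x \<in> H \<and> y \<in> ?Y}"
      using H(2) Y(1) by (simp only: span_Un span_eq_iff[THEN iffD2])
    moreover have "{x + y | x y. x \<in> H \<and> y \<in> ?Y} = ?V \<longleftrightarrow> snd ` H = F2" (is "?S = _ \<longleftrightarrow> _")
    proof
      assume S: "?S = ?V"
      show "snd ` H = F2"
      proof
        show "snd ` H \<subseteq> F2" using H(1) by auto
        show "F2 \<subseteq> snd ` H"
        proof
          fix b assume "b \<in> F2"
          then have "(0, b) \<in> ?S" unfolding S using zero by simp
          then obtain x y where "(0, b) = x + y" "x \<in> H" "y \<in> ?Y" by blast
          then have "b = snd x" by (auto simp: prod_eq_iff)
          then show "b \<in> snd ` H" using \<open>x \<in> H\<close> by blast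
        qed
      qed
    next
      assume snd: "snd ` H = F2"
      show "?S = ?V"
      proof
        show "?S \<subseteq> ?V" using H(1) Y(2) subspace_V subspace_add by blast
        show "?V \<subseteq> ?S"
        proof
          fix z assume z: "z \<in> ?V"
          then obtain x where x: "x \<in> H" "snd x = snd z" using snd by force
          have "z - x \<in> ?V" using z x(1) H(1) subspace_V subspace_diff by blast
          then have "z - x \<in> ?Y" using x(2) by (auto simp: mem_Times_iff)
          then have "z = x + (z - x) \<and> x \<in> H \<and> z - x \<in> ?Y" using x(1) by simp
          then show "z \<in> ?S" by (intro CollectI exI[of _ x] exI[of _ "z - x"])
        qed
      qed
    qed
    ultimately show ?thesis by simp
  qed
  \<comment> \<open>Here \<open>j \<le> k1\<close> enters: a \<open>j\<close>-dimensional subspace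
    fits inside \<open>?Y\<close>, where it meets \<open>?W\<close> only in zero, so an admissible
    subcode exists.\<close>
  obtain U where U: "subspace U" "U \<subseteq> ?Y" "dim U = j"
    using subspace_of_dim_exists[OF Y(1), of j] assms(15) dim_Y by auto
  have "U \<inter> ?W = {0}"
    using U(2) subspace_0[OF U(1)] zero by (auto simp: zero_prod_def)
  then have "int (rel_gen_hamming_weight j C C') = int n -
    int (Max {card {i. i < n \<and> ?g i \<in> H} | H. H \<subseteq> ?V \<and> subspace H \<and> dim H = dim ?V - j \<and>
      span (H \<union> perp ?W) = ?V})"
    unfolding C using rel_gen_hamming_weight_eq[OF W U(1) _ _ U(3)] U(2) Y(2) by blast
  also have "{card {i. i < n \<and> ?g i \<in> H} | H. H \<subseteq> ?V \<and> subspace H \<and> dim H = dim ?V - j \<and>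
      span (H \<union> perp ?W) = ?V}
    = {card (H \<inter> {?g i | i. 1 \<le> i \<and> i \<le> n}) | H. H \<subseteq> ?V \<and> subspace H \<and> dim H = k1 + k2 - j \<and>
      snd ` H = F2}"
    unfolding perp_W dim_V card_Int_cyclic[OF assms(2,3) n] using span_iff by blast
  finally show ?thesis .
qed

end
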